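(* Let $(s_0,b_0,b_1,s_1)\in\Theta$. Let $\kappa=\lambda[\mathbf K]^{-1}\mathbf 1_{\mathbf K}$, where $\mathbf K\subset\mathbb R^D$ is compact (with $\lambda[\mathbf K]>0$), and let $\Upsilon$ be the corresponding RealLife Euclidean automaton. Let $\mathbf A\subset\mathbb R^D$ be a Borel set. Suppose $\lambda[\mathbf A]/\lambda[\mathbf K]\in[s_0,b_0)$ and $(\mathbf A-\mathbf A)\subset\mathbf K$. Then $\mathbf 1_{\mathbf A}$ is a still life, i.e. $\Upsilon(\mathbf 1_{\mathbf A})=\mathbf 1_{\mathbf A}$.
   Context: $\lambda$ is Lebesgue measure on $\mathbb R^D$. $\Theta=\{(s_0,b_0,b_1,s_1): 0<s_0\le b_0<b_1\le s_1\le 1\}$. $\mathbf A-\mathbf A=\{x-y: x,y\in\mathbf A\}$. For a nonnegative bounded compactly supported kernel $\kappa$ with integral $1$, $(\kappa*\mathbf a)(x)=\int\kappa(y)\mathbf a(x-y)\,d\lambda(y)$, and the RealLife Euclidean automaton acts on Borel functions $\mathbf a:\mathbb R^D\to\{0,1\}$ by $$\Upsilon(\mathbf a)(x)=\mathbf a(x)\mathbf 1_{[s_0,s_1]}(\kappa*\mathbf a(x))+(1-\mathbf a(x))\mathbf 1_{[b_0,b_1]}(\kappa*\mathbf a(x)).$$ *)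

theory Defs
  imports "HOL-Analysis.Analysis"
begin

definition reallife_params :: "(real \<times> real \<times> real \<times> real) set" where
  "reallife_params = {(s\<^sub>0, b\<^sub>0, b\<^sub>1, s\<^sub>1). 0 < s\<^sub>0 \<and> s\<^sub>0 \<le> b\<^sub>0 \<and> b\<^sub>0 < b\<^sub>1 \<and> b\<^sub>1 \<le> s\<^sub>1 \<and> s\<^sub>1 \<le> 1}"

(* Cell states are the reals 0 and 1, so that configurations can be integrated. *)
definition configurations :: "('a::euclidean_space \<Rightarrow> real) set" where
  "configurations = {a \<in> borel_measurable borel. range a \<subseteq> {0, 1}}"

definition is_kernel :: "('a::euclidean_space \<Rightarrow> real) \<Rightarrow> bool" where
  "is_kernel \<kappa> \<longleftrightarrow>
     \<kappa> \<in> borel_measurable borel \<and> (\<forall>x. 0 \<le> \<kappa> x) \<and> bounded (range \<kappa>) \<and>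
     compact (closure {x. \<kappa> x \<noteq> 0}) \<and> integrable lborel \<kappa> \<and> (LINT y|lborel. \<kappa> y) = 1"

definition kernel_conv :: "('a::euclidean_space \<Rightarrow> real) \<Rightarrow> ('a \<Rightarrow> real) \<Rightarrow> 'a \<Rightarrow> real" where
  "kernel_conv \<kappa> a x = (LINT y|lborel. \<kappa> y * a (x - y))"

definition reallife ::
    "real \<times> real \<times> real \<times> real \<Rightarrow> ('a::euclidean_space \<Rightarrow> real) \<Rightarrow> ('a \<Rightarrow> real) \<Rightarrow> 'a \<Rightarrow> real" where
  "reallife = (\<lambda>(s\<^sub>0, b\<^sub>0, b\<^sub>1, s\<^sub>1) \<kappa> a x.
     a x * indicator {s\<^sub>0..s\<^sub>1} (kernel_conv \<kappa> a x)
     + (1 - a x) * indicator {b\<^sub>0..b\<^sub>1} (kernel_conv \<kappa> a x))"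

definition still_life :: "(('a::euclidean_space \<Rightarrow> real) \<Rightarrow> 'a \<Rightarrow> real) \<Rightarrow> ('a \<Rightarrow> real) \<Rightarrow> bool" where
  "still_life F a \<longleftrightarrow> a \<in> configurations \<and> F a = a"

definition uniform_kernel :: "'a::euclidean_space set \<Rightarrow> 'a \<Rightarrow> real" where
  "uniform_kernel K x = inverse (measure lborel K) * indicator K x"

lemma is_kernel_uniform_kernel:
  fixes K :: "'a::euclidean_space set"
  assumes "compact K" "0 < measure lborel K"
  shows "is_kernel (uniform_kernel K)"
proof -
  have [measurable]: "K \<in> sets borel"
    using assms by (simp add: borel_compact)
  have fin: "emeasure lborel K < \<infinity>"
    using assms(1) emeasure_compact_finite by blast
  have meas: "uniform_kernel K \<in> borel_measurable borel"
    unfolding uniform_kernel_def by measurable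
  have "range (uniform_kernel K) \<subseteq> {0, inverse (measure lborel K)}"
    by (auto simp: uniform_kernel_def indicator_def)
  then have bdd: "bounded (range (uniform_kernel K))"
    by (meson bounded_subset finite.emptyI finite.insertI finite_imp_bounded)
  have "{x. uniform_kernel K x \<noteq> 0} = K"
    using assms(2) by (auto simp: uniform_kernel_def indicator_def)
  then have supp: "compact (closure {x. uniform_kernel K x \<noteq> 0})"
    using assms(1) by (simp add: compact_imp_closed)
  have "integrable lborel (uniform_kernel K)"
    unfolding uniform_kernel_def using fin by simp
  moreover have "integral\<^sup>L lborel (uniform_kernel K) = 1"
    unfolding uniform_kernel_def using assms(2) fin by simp
  ultimately have "integrable lborel (uniform_kernel K) \<and> integral\<^sup>L lborel (uniform_kernel K) = 1"
    by simp
  then show ?thesis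
    using meas bdd supp assms(2) unfolding is_kernel_def
    by (simp add: uniform_kernel_def)
qed

end

theory Submission
  imports Defs
begin

text \<open>
  The uniform kernel averages an indicator over a translate of the reflected neighbourhood: at \<open>x\<close>
  the convolution is the proportion of \<open>K\<close> covered by \<open>x - A\<close>. It never exceeds
  \<open>measure lborel A / measure lborel K < b\<^sub>0\<close>, so nothing is born. If \<open>x \<in> A\<close>, then
  \<open>x - A \<subseteq> A - A \<subseteq> K\<close> gives equality, so \<open>x\<close> survives.
\<close>

text \<open>Point reflection followed by translation is affine with linear part -1, so the Jacobian
  factor in \<open>lborel_affine\<close> is a power of |-1|, i.e. 1, and the density
  disappears.\<close>

lemma emeasure_lborel_vimage_diff:
  fixes x :: "'a::euclidean_space"
  assumes "A \<in> sets borel"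
  shows "emeasure lborel ((\<lambda>y. x - y) -` A) = emeasure lborel A"
proof -
  have "(lborel :: 'a measure) = distr lborel borel (\<lambda>y. x - y)"
    using lborel_affine[of "-1::real" x] by (simp add: density_1)
  then have "emeasure lborel A = emeasure (distr lborel borel (\<lambda>y. x - y)) A"
    by simp
  also have "\<dots> = emeasure lborel ((\<lambda>y. x - y) -` A)"
    using assms by (subst emeasure_distr) auto
  finally show ?thesis ..
qed

lemma kernel_conv_uniform_kernel_indicator:
  fixes K A :: "'a::euclidean_space set"
  assumes "K \<in> sets borel" "A \<in> sets borel"
  shows "kernel_conv (uniform_kernel K) (indicator A) x =
           measure lborel (K \<inter> (\<lambda>y. x - y) -` A) / measure lborel K"
proof -
  have "uniform_kernel K y * indicator A (x - y) =
          inverse (measure lborel K) * indicator (K \<inter> (\<lambda>y. x - y) -` A) y" for y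
    by (simp add: uniform_kernel_def indicator_def)
  then show ?thesis
    by (simp add: kernel_conv_def divide_inverse mult.commute)
qed

theorem proposition3p3:
  fixes s\<^sub>0 b\<^sub>0 b\<^sub>1 s\<^sub>1 :: real
    and K A :: "(real ^ 'd) set"
  assumes "(s\<^sub>0, b\<^sub>0, b\<^sub>1, s\<^sub>1) \<in> reallife_params"
    and "compact K"
    and "measure lborel K > 0"
    and "A \<in> sets borel"
    and "measure lborel A / measure lborel K \<in> {s\<^sub>0..<b\<^sub>0}"
    and "{x - y | x y. x \<in> A \<and> y \<in> A} \<subseteq> K"
  shows "still_life (reallife (s\<^sub>0, b\<^sub>0, b\<^sub>1, s\<^sub>1) (uniform_kernel K)) (indicator A)"
proof -
  let ?c = "kernel_conv (uniform_kernel K) (indicator A)"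
  have params: "0 < s\<^sub>0" "b\<^sub>0 < b\<^sub>1" "b\<^sub>1 \<le> s\<^sub>1"
    using assms(1) by (auto simp: reallife_params_def)
  have K: "K \<in> sets borel"
    using assms(2) by (simp add: borel_compact)
  have ratio: "s\<^sub>0 \<le> measure lborel A / measure lborel K" "measure lborel A / measure lborel K < b\<^sub>0"
    using assms(5) by auto
  have "measure lborel A \<noteq> 0"
    using ratio(1) params(1) by auto
  \<comment> \<open>\<open>measure\<close> is \<open>0\<close> on sets of infinite measure\<close>
  then have finite: "emeasure lborel A \<noteq> \<infinity>"
    by (auto simp: measure_def)
  have refl: "measure lborel ((\<lambda>y. x - y) -` A) = measure lborel A" for x
    by (simp add: measure_def emeasure_lborel_vimage_diff[OF assms(4)])
  have refl_sets: "(\<lambda>y. x - y) -` A \<in> sets borel" for x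
    using measurable_sets[of "\<lambda>y. x - y" borel borel A] assms(4) by simp
  \<comment> \<open>Monotonicity of the real-valued \<open>measure\<close> needs the larger set to
    have finite measure; here that set is the reflected copy of \<open>A\<close>.\<close>
  have refl_fm: "(\<lambda>y. x - y) -` A \<in> fmeasurable lborel" for x
  proof (rule fmeasurableI)
    show "(\<lambda>y. x - y) -` A \<in> sets lborel"
      using refl_sets by simp
    show "emeasure lborel ((\<lambda>y. x - y) -` A) < \<infinity>"
      using finite by (simp add: emeasure_lborel_vimage_diff[OF assms(4)] less_top)
  qed
  have le: "?c x \<le> measure lborel A / measure lborel K" for x
  proof -
    have "measure lborel (K \<inter> (\<lambda>y. x - y) -` A) \<le> measure lborel A"
      unfolding refl[of x, symmetric] using K refl_sets refl_fm
      by (intro measure_mono_fmeasurable) auto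
    then show ?thesis
      using assms(3) by (simp add: kernel_conv_uniform_kernel_indicator[OF K assms(4)] divide_right_mono)
  qed
  have eq: "?c x = measure lborel A / measure lborel K" if "x \<in> A" for x
  proof -
    have "y \<in> K" if "x - y \<in> A" for y
    proof -
      \<comment> \<open>Writes \<open>y\<close> as a difference of two points of \<open>A\<close>,
        which is the form that the inclusion into \<open>K\<close> requires.\<close>
      have "y = x - (x - y)" by simp
      then show ?thesis using assms(6) \<open>x \<in> A\<close> that by blast
    qed
    then have "K \<inter> (\<lambda>y. x - y) -` A = (\<lambda>y. x - y) -` A"
      by auto
    then show ?thesis
      by (simp add: kernel_conv_uniform_kernel_indicator[OF K assms(4)] refl)
  qed
  have "reallife (s\<^sub>0, b\<^sub>0, b\<^sub>1, s\<^sub>1) (uniform_kernel K) (indicator A) x = indicator A x" for x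
  proof (cases "x \<in> A")
    case True
    \<comment> \<open>The common value lies in \<open>{s\<^sub>0..<b\<^sub>0}\<close>, and
      \<open>b\<^sub>0 < b\<^sub>1 \<le> s\<^sub>1\<close> puts it inside the survival
      interval.\<close>
    then show ?thesis
      using eq[OF True] ratio params by (simp add: reallife_def)
  next
    case False
    \<comment> \<open>Outside \<open>A\<close> only the upper bound is available, but falling below
      the birth interval is enough.\<close>
    have "?c x < b\<^sub>0"
      using le[of x] ratio(2) by linarith
    with False show ?thesis
      by (simp add: reallife_def)
  qed
  moreover have "indicator A \<in> configurations"
    using assms(4) by (auto simp: configurations_def indicator_def)
  ultimately show ?thesis
    by (auto simp: still_life_def)
qed

end
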